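(* For all integers $m\ge 1$ and $n\ge 1$ and every disjunctive program $D\in\mathcal{DP}_{n,m}$, $D$ has at most $m^n$ answer sets. Moreover, the program $D(n,m)$ is (up to renaming atoms) the only program in $\mathcal{DP}_{n,m}$ with exactly $m^n$ answer sets. In particular, $d(n,m)=m^n$.
   Context: A disjunctive (propositional) program is a finite set of clauses $a_1\vee\cdots\vee a_k\leftarrow b_1,\ldots,b_p,\mathbf{not}(c_1),\ldots,\mathbf{not}(c_q)$ with $k\ge 1$, $p,q\ge 0$ and all $a_i,b_i,c_i$ atoms. The length of such a clause is $k+p+q$. A set of atoms $M$ satisfies a negation-free clause $a_1\vee\cdots\vee a_k\leftarrow b_1,\ldots,b_p$ if $\{b_1,\ldots,b_p\}\subseteq M$ implies $a_i\in M$ for some $i$. For a set of atoms $M$, the Gelfond–Lifschitz reduct $D^M$ is obtained from $D$ by deleting every clause whose body contains $\mathbf{not}(c)$ with $c\in M$ and deleting all negative literals from the remaining clauses; $M$ is an answer set of $D$ if $M$ is a minimal model of $D^M$. $\mathcal{DP}_{n,m}$ is the class of disjunctive programs with at most $n$ clauses, each of length at most $m$; $d(n,m)$ is the maximum number of answer sets of a program in $\mathcal{DP}_{n,m}$. $D(n,m)$ is the program consisting of the $n$ clauses $a_{i,1}\vee\cdots\vee a_{i,m}\leftarrow$ ($i=1,\ldots,n$), with all atoms $a_{i,j}$ pairwise distinct.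
   Formalization: For m = 1 the uniqueness claim is stated only for programs with exactly n clauses, since any program with fewer than n facts (e.g. the empty one) also has exactly 1 = 1^n answer set; d(n,m) = m^n is stated for an infinite supply of atoms. *)

theory Defs
  imports Main
begin

text \<open>A clause is given by the set of its head atoms, the set of its positive body atoms and the
  set of its negated body atoms; the order of the literals is immaterial. A clause is negation-free
  iff its third component is empty.\<close>

datatype 'a clause = Clause (heads: "'a set") (pos_body: "'a set") (neg_body: "'a set")

type_synonym 'a program = "'a clause set"

definition wf_clause :: "'a clause \<Rightarrow> bool" where
  "wf_clause C \<longleftrightarrow>
     heads C \<noteq> {} \<and> finite (heads C) \<and> finite (pos_body C) \<and> finite (neg_body C)"

definition disjunctive_program :: "'a program \<Rightarrow> bool" where
  "disjunctive_program D \<longleftrightarrow> finite D \<and> (\<forall>C\<in>D. wf_clause C)"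

definition clause_length :: "'a clause \<Rightarrow> nat" where
  "clause_length C = card (heads C) + card (pos_body C) + card (neg_body C)"

text \<open>Satisfaction and models are used for negation-free clauses only (those of a reduct), hence
  the negated body atoms play no role here.\<close>

definition satisfies :: "'a set \<Rightarrow> 'a clause \<Rightarrow> bool" where
  "satisfies M C \<longleftrightarrow> (pos_body C \<subseteq> M \<longrightarrow> (\<exists>a\<in>heads C. a \<in> M))"

definition is_model :: "'a set \<Rightarrow> 'a program \<Rightarrow> bool" where
  "is_model M P \<longleftrightarrow> (\<forall>C\<in>P. satisfies M C)"

definition minimal_model :: "'a set \<Rightarrow> 'a program \<Rightarrow> bool" where
  "minimal_model M P \<longleftrightarrow> is_model M P \<and> (\<forall>N. N \<subset> M \<longrightarrow> \<not> is_model N P)"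

definition reduct :: "'a program \<Rightarrow> 'a set \<Rightarrow> 'a program" where
  "reduct D M = (\<lambda>C. Clause (heads C) (pos_body C) {}) ` {C \<in> D. neg_body C \<inter> M = {}}"

definition answer_set :: "'a program \<Rightarrow> 'a set \<Rightarrow> bool" where
  "answer_set D M \<longleftrightarrow> minimal_model M (reduct D M)"

definition answer_sets :: "'a program \<Rightarrow> 'a set set" where
  "answer_sets D = {M. answer_set D M}"

definition DP :: "nat \<Rightarrow> nat \<Rightarrow> 'a program set" where
  "DP n m = {D. disjunctive_program D \<and> card D \<le> n \<and> (\<forall>C\<in>D. clause_length C \<le> m)}"

text \<open>The maximum depends on the supply of atoms, which is the type argument; it is intended to
  be infinite.\<close>

definition max_answer_sets :: "'a itself \<Rightarrow> nat \<Rightarrow> nat \<Rightarrow> nat" where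
  "max_answer_sets _ n m = Max ((\<lambda>D. card (answer_sets D)) ` (DP n m :: 'a program set))"

text \<open>The program $D(n,m)$; the atom $a_{i,j}$ is the pair $(i,j)$.\<close>

definition D_prog :: "nat \<Rightarrow> nat \<Rightarrow> (nat \<times> nat) program" where
  "D_prog n m = (\<lambda>i. Clause {(i, j) |j. j \<in> {1..m}} {} {}) ` {1..n}"

definition clause_atoms :: "'a clause \<Rightarrow> 'a set" where
  "clause_atoms C = heads C \<union> pos_body C \<union> neg_body C"

definition atoms :: "'a program \<Rightarrow> 'a set" where
  "atoms D = (\<Union>C\<in>D. clause_atoms C)"

definition rename_clause :: "('a \<Rightarrow> 'b) \<Rightarrow> 'a clause \<Rightarrow> 'b clause" where
  "rename_clause f C = Clause (f ` heads C) (f ` pos_body C) (f ` neg_body C)"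

definition equal_up_to_renaming :: "'a program \<Rightarrow> 'b program \<Rightarrow> bool" where
  "equal_up_to_renaming D E \<longleftrightarrow> (\<exists>f. inj_on f (atoms D) \<and> E = rename_clause f ` D)"

text \<open>For $m = 1$ the uniqueness of $D(n,m)$ requires the number of clauses to be exactly $n$: the
  empty program also has $1^n$ answer sets.\<close>

lemma empty_program_counterexample:
  assumes "1 \<le> n"
  shows "({} :: 'a program) \<in> DP n 1" "card (answer_sets ({} :: 'a program)) = 1 ^ n"
    "\<not> equal_up_to_renaming (D_prog n 1) ({} :: 'a program)"
proof -
  show "({} :: 'a program) \<in> DP n 1"
    by (simp add: DP_def disjunctive_program_def)
  have "answer_sets ({} :: 'a program) = {{}}"
    by (auto simp: answer_sets_def answer_set_def minimal_model_def is_model_def reduct_def)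
  then show "card (answer_sets ({} :: 'a program)) = 1 ^ n" by simp
  show "\<not> equal_up_to_renaming (D_prog n 1) ({} :: 'a program)"
    using assms by (auto simp: equal_up_to_renaming_def D_prog_def)
qed

end

theory Submission
  imports Defs "HOL-Library.FuncSet" "HOL-Library.Nat_Bijection"
begin

text \<open>Every answer set \<open>M\<close> makes some literal of a fixed clause \<open>C\<close> true: a head atom or a negated
  atom lies in \<open>M\<close>, or a positive body atom does not. Fixing the truth value of that atom turns
  \<open>D\<close> into a simplified program which no longer contains \<open>C\<close> and of which \<open>M\<close>, without that atom,
  is an answer set. A clause has at most \<open>m\<close> literals, so the bound \<open>m ^ n\<close> follows by induction; the
  simplification may empty the head of a clause, so the induction runs over programs with
  constraints. If the bound is attained and \<open>m \<ge> 2\<close>, all clauses have length \<open>m\<close> and every branch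
  attains its own bound, so that the simplification cannot touch any clause other than \<open>C\<close>; hence no
  two clauses share an atom. Since an atom of an answer set must be supported by a clause with that
  atom in its head, a body atom of \<open>C\<close> would then make some branch too large or empty.\<close>

section \<open>Answer sets read off from the clauses of the program\<close>

lemma answer_set_iff:
  "answer_set D M \<longleftrightarrow>
     (\<forall>C\<in>D. neg_body C \<inter> M = {} \<longrightarrow> pos_body C \<subseteq> M \<longrightarrow> heads C \<inter> M \<noteq> {}) \<and>
     (\<forall>N. N \<subset> M \<longrightarrow> (\<exists>C\<in>D. neg_body C \<inter> M = {} \<and> pos_body C \<subseteq> N \<and> heads C \<inter> N = {}))"
proof -
  have "is_model N (reduct D M) \<longleftrightarrow>
      (\<forall>C\<in>D. neg_body C \<inter> M = {} \<longrightarrow> pos_body C \<subseteq> N \<longrightarrow> heads C \<inter> N \<noteq> {})" for N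
    unfolding is_model_def reduct_def satisfies_def by auto
  then show ?thesis
    unfolding answer_set_def minimal_model_def by simp
qed

lemma answer_set_model:
  assumes "answer_set D M" "C \<in> D" "neg_body C \<inter> M = {}" "pos_body C \<subseteq> M"
  shows "heads C \<inter> M \<noteq> {}"
  using assms answer_set_iff[THEN iffD1, THEN conjunct1] by blast

lemma answer_set_minimal:
  assumes "answer_set D M" "N \<subset> M"
  obtains C where "C \<in> D" "neg_body C \<inter> M = {}" "pos_body C \<subseteq> N" "heads C \<inter> N = {}"
proof -
  have "\<exists>C\<in>D. neg_body C \<inter> M = {} \<and> pos_body C \<subseteq> N \<and> heads C \<inter> N = {}"
    using assms unfolding answer_set_iff by presburger
  then show thesis using that by blast
qed

text \<open>By minimality, \<open>M - {a}\<close> violates some clause of the reduct. Since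
  \<open>M\<close> satisfies that clause, \<open>a\<close> is the head atom that was lost.\<close>

lemma answer_set_supported:
  assumes "answer_set D M" "a \<in> M"
  obtains C where "C \<in> D" "a \<in> heads C" "a \<notin> pos_body C" "a \<notin> neg_body C"
proof -
  have "M - {a} \<subset> M" using assms(2) by auto
  then obtain C where C: "C \<in> D" "neg_body C \<inter> M = {}" "pos_body C \<subseteq> M - {a}"
      "heads C \<inter> (M - {a}) = {}"
    by (rule answer_set_minimal[OF assms(1)])
  moreover have "heads C \<inter> M \<noteq> {}"
    using C(3) by (intro answer_set_model[OF assms(1) C(1,2)]) blast
  ultimately show thesis using that[of C] assms(2) by blast
qed


section \<open>Branching on the literals of a clause\<close>

text \<open>The pair \<open>(v, a)\<close> says that the clause is satisfied as soon as \<open>a\<close> has truth value \<open>v\<close>.\<close>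

definition literals :: "'a clause \<Rightarrow> (bool \<times> 'a) set" where
  "literals C = Pair True ` (heads C \<union> neg_body C) \<union> Pair False ` pos_body C"

definition remove_atom :: "'a \<Rightarrow> 'a clause \<Rightarrow> 'a clause" where
  "remove_atom a C = Clause (heads C - {a}) (pos_body C - {a}) (neg_body C - {a})"

text \<open>Clauses made true by the value of \<open>a\<close> disappear. In the others, every
  occurrence of \<open>a\<close> is a false disjunct of the clause and can be erased.\<close>

definition assign :: "bool \<Rightarrow> 'a \<Rightarrow> 'a program \<Rightarrow> 'a program" where
  "assign v a D = remove_atom a ` {C \<in> D. (v, a) \<notin> literals C}"

lemma literals_iff:
  "(v, a) \<in> literals C \<longleftrightarrow> (if v then a \<in> heads C \<union> neg_body C else a \<in> pos_body C)"
  by (auto simp: literals_def)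

lemma atom_in_literals: "a \<in> clause_atoms C \<Longrightarrow> \<exists>v. (v, a) \<in> literals C"
  by (auto simp: clause_atoms_def literals_def)

lemma finite_literals: "finite (clause_atoms C) \<Longrightarrow> finite (literals C)"
  by (simp add: literals_def clause_atoms_def)

text \<open>Equality can fail: an atom both in the head and under negation is a single literal but
  counts twice in the length.\<close>

lemma card_literals_le: "card (literals C) \<le> clause_length C"
proof -
  have "card (literals C) \<le>
      card (Pair True ` (heads C \<union> neg_body C)) + card (Pair False ` pos_body C)"
    unfolding literals_def by (rule card_Un_le)
  also have "\<dots> = card (heads C \<union> neg_body C) + card (pos_body C)"
    by (simp add: card_image inj_on_def)
  also have "\<dots> \<le> clause_length C"
    using card_Un_le[of "heads C" "neg_body C"] by (simp add: clause_length_def)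
  finally show ?thesis .
qed

lemma clause_length_remove_atom_le:
  "clause_length (remove_atom a C) \<le> clause_length C"
  by (simp add: clause_length_def remove_atom_def add_mono card_Diff1_le)

lemma clause_length_remove_atom_less:
  assumes "finite (clause_atoms C)" "a \<in> clause_atoms C"
  shows "clause_length (remove_atom a C) < clause_length C"
proof -
  have fin: "finite (heads C)" "finite (pos_body C)" "finite (neg_body C)"
    using assms(1) by (auto simp: clause_atoms_def)
  have less: "card (S - {a}) < card S" if "finite S" "a \<in> S" for S
    using that by (rule card_Diff1_less)
  have le: "card (S - {a}) \<le> card S" for S
    by (rule card_Diff1_le)
  consider "a \<in> heads C" | "a \<in> pos_body C" | "a \<in> neg_body C"
    using assms(2) by (auto simp: clause_atoms_def)
  then have "card (heads C - {a}) < card (heads C) \<or> card (pos_body C - {a}) < card (pos_body C) \<or>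
      card (neg_body C - {a}) < card (neg_body C)"
    using fin less by cases blast+
  then show ?thesis
    unfolding clause_length_def remove_atom_def clause.sel
    using le[of "heads C"] le[of "pos_body C"] le[of "neg_body C"] by linarith
qed

text \<open>The converse fails, as a true \<open>a\<close> need not be supported in
  \<open>D\<close>. An upper bound only needs this direction.\<close>

lemma answer_set_assign:
  assumes M: "answer_set D M" and v: "(a \<in> M) = v"
  shows "answer_set (assign v a D) (M - {a})"
  unfolding answer_set_iff
proof (intro conjI allI impI ballI)
  fix C' assume "C' \<in> assign v a D" and neg: "neg_body C' \<inter> (M - {a}) = {}"
    and pos: "pos_body C' \<subseteq> M - {a}"
  then obtain C where C: "C \<in> D" "(v, a) \<notin> literals C" "C' = remove_atom a C"
    by (auto simp: assign_def)
  have "neg_body C \<inter> M = {}" "pos_body C \<subseteq> M"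
    using neg pos C v by (auto simp: literals_iff remove_atom_def split: if_splits)
  then have "heads C \<inter> M \<noteq> {}"
    by (rule answer_set_model[OF M C(1)])
  then show "heads C' \<inter> (M - {a}) \<noteq> {}"
    using C v by (auto simp: literals_iff remove_atom_def split: if_splits)
next
  fix N assume N: "N \<subset> M - {a}"
  \<comment> \<open>Giving \<open>a\<close> back its value turns a competitor of
    \<open>M - {a}\<close> into a competitor of \<open>M\<close>, so minimality of \<open>M\<close>
    applies.\<close>
  define N' where "N' = (if v then insert a N else N)"
  have "N' \<subset> M" using N v by (auto simp: N'_def)
  then obtain C where C: "C \<in> D" "neg_body C \<inter> M = {}" "pos_body C \<subseteq> N'" "heads C \<inter> N' = {}"
    by (rule answer_set_minimal[OF M])
  \<comment> \<open>The clause violated by \<open>N'\<close> survives the assignment: an occurrence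
    of \<open>(v, a)\<close> would satisfy it in \<open>N'\<close> or delete it from the
    reduct.\<close>
  have "(v, a) \<notin> literals C"
    using C N v by (auto simp: literals_iff N'_def split: if_splits)
  then have "remove_atom a C \<in> assign v a D"
    using C(1) by (auto simp: assign_def)
  moreover have "neg_body (remove_atom a C) \<inter> (M - {a}) = {}"
      "pos_body (remove_atom a C) \<subseteq> N" "heads (remove_atom a C) \<inter> N = {}"
    using C by (auto simp: remove_atom_def N'_def split: if_splits)
  ultimately show "\<exists>C\<in>assign v a D.
      neg_body C \<inter> (M - {a}) = {} \<and> pos_body C \<subseteq> N \<and> heads C \<inter> N = {}"
    by blast
qed

definition branch :: "'a program \<Rightarrow> bool \<times> 'a \<Rightarrow> 'a set set" where
  "branch D l = {M \<in> answer_sets D. (snd l \<in> M) = fst l}"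

text \<open>All sets in a branch agree on \<open>a\<close>, so deleting \<open>a\<close> from them
  is injective.\<close>

lemma card_branch_le:
  assumes "finite (answer_sets (assign v a D))"
  shows "finite (branch D (v, a))" "card (branch D (v, a)) \<le> card (answer_sets (assign v a D))"
proof -
  have inj: "inj_on (\<lambda>M. M - {a}) (branch D (v, a))"
    by (rule inj_onI) (auto simp: branch_def)
  have sub: "(\<lambda>M. M - {a}) ` branch D (v, a) \<subseteq> answer_sets (assign v a D)"
    by (auto simp: branch_def answer_sets_def intro: answer_set_assign)
  show "finite (branch D (v, a))" using inj sub assms by (rule inj_on_finite)
  show "card (branch D (v, a)) \<le> card (answer_sets (assign v a D))"
    using inj sub assms by (rule card_inj_on_le)
qed

text \<open>A clause absent from the reduct is covered too: one of its negated atoms lies in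
  \<open>M\<close>, which is again a true literal. The branches may overlap.\<close>

lemma answer_sets_eq_Union_branch:
  assumes "C \<in> D"
  shows "answer_sets D = (\<Union>l\<in>literals C. branch D l)"
proof
  show "answer_sets D \<subseteq> (\<Union>l\<in>literals C. branch D l)"
  proof
    fix M assume M: "M \<in> answer_sets D"
    then have "neg_body C \<inter> M = {} \<longrightarrow> pos_body C \<subseteq> M \<longrightarrow> heads C \<inter> M \<noteq> {}"
      using assms by (auto simp: answer_sets_def answer_set_iff)
    then have "\<exists>v a. (v, a) \<in> literals C \<and> (a \<in> M) = v"
      by (auto simp: literals_iff)
    then show "M \<in> (\<Union>l\<in>literals C. branch D l)"
      using M by (force simp: branch_def)
  qed
qed (auto simp: branch_def)


section \<open>The upper bound\<close>

text \<open>A relaxation of \<open>DP\<close> that allows empty heads and is therefore closed under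
  \<open>assign\<close>. Finiteness is required explicitly because an infinite set has
  \<open>card\<close> 0 and would escape the length bound.\<close>

definition bounded_program :: "nat \<Rightarrow> nat \<Rightarrow> 'a program \<Rightarrow> bool" where
  "bounded_program n m D \<longleftrightarrow>
     finite D \<and> card D \<le> n \<and> (\<forall>C\<in>D. finite (clause_atoms C) \<and> clause_length C \<le> m)"

lemma DP_bounded_program: "D \<in> DP n m \<Longrightarrow> bounded_program n m D"
  by (auto simp: DP_def bounded_program_def disjunctive_program_def wf_clause_def clause_atoms_def)

lemma bounded_program_assign:
  assumes D: "bounded_program n m D" and C: "C \<in> D" "(v, a) \<in> literals C"
  shows "bounded_program (n - 1) m (assign v a D)"
proof -
  have fin: "finite D" using D by (simp add: bounded_program_def)
  have "card (assign v a D) \<le> card {C \<in> D. (v, a) \<notin> literals C}"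
    unfolding assign_def using fin by (simp add: card_image_le)
  also have "\<dots> \<le> card (D - {C})"
    using fin C by (intro card_mono) auto
  also have "\<dots> \<le> n - 1"
    using fin C D by (auto simp: bounded_program_def)
  finally have "card (assign v a D) \<le> n - 1" .
  moreover have "finite (clause_atoms (remove_atom a B)) \<and> clause_length (remove_atom a B) \<le> m"
    if "B \<in> D" for B
    using that D clause_length_remove_atom_le[of a B]
    by (fastforce simp: bounded_program_def remove_atom_def clause_atoms_def)
  ultimately show ?thesis
    using fin by (auto simp: bounded_program_def assign_def)
qed

lemma card_Union_branch_le:
  assumes "finite L" "\<And>l. l \<in> L \<Longrightarrow> card (branch D l) \<le> k"
  shows "card (\<Union>l\<in>L. branch D l) \<le> card L * k"
  using card_UN_le[OF assms(1), of "branch D"] sum_bounded_above[of L "\<lambda>l. card (branch D l)" k]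
    assms(2) by simp

lemma answer_sets_empty: "answer_sets {} = {{}}"
  by (auto simp: answer_sets_def answer_set_iff)

lemma card_answer_sets_le:
  assumes "1 \<le> m" "bounded_program n m D"
  shows "finite (answer_sets D) \<and> card (answer_sets D) \<le> m ^ n"
  using assms(2)
proof (induction n arbitrary: D)
  case 0
  then have "D = {}" by (auto simp: bounded_program_def)
  then show ?case by (simp add: answer_sets_empty)
next
  case (Suc n)
  show ?case
  proof (cases "D = {}")
    case True
    \<comment> \<open>There is no clause to branch on; the single answer set \<open>{}\<close> fits
      the bound because \<open>1 \<le> m\<close>.\<close>
    then show ?thesis using assms(1) by (simp add: answer_sets_empty Suc_le_eq)
  next
    case False
    then obtain C where C: "C \<in> D" by blast
    have fC: "finite (clause_atoms C)" and lC: "clause_length C \<le> m"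
      using C Suc.prems by (auto simp: bounded_program_def)
    have br: "finite (branch D l) \<and> card (branch D l) \<le> m ^ n" if "l \<in> literals C" for l
    proof (cases l)
      case (Pair v a)
      then have "bounded_program n m (assign v a D)"
        using bounded_program_assign[OF Suc.prems C] that by fastforce
      from Suc.IH[OF this] show ?thesis
        using card_branch_le[of v a D] Pair by auto
    qed
    have "card (answer_sets D) \<le> card (literals C) * m ^ n"
      unfolding answer_sets_eq_Union_branch[OF C]
      using br by (intro card_Union_branch_le finite_literals fC) auto
    also have "\<dots> \<le> m * m ^ n"
      using card_literals_le[of C] lC by (intro mult_le_mono1) linarith
    finally show ?thesis
      using br finite_literals[OF fC] by (simp add: answer_sets_eq_Union_branch[OF C])
  qed
qed


section \<open>Programs attaining the bound\<close>

context
  fixes n m :: nat and D :: "'a program"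
  assumes m2: "2 \<le> m" and D: "bounded_program n m D" and ext: "card (answer_sets D) = m ^ n"
begin

text \<open>A missing clause would lower the bound to \<open>m ^ (n - 1)\<close>, which is strictly
  smaller because \<open>2 \<le> m\<close>.\<close>

lemma extremal_card: "card D = n"
proof (rule ccontr)
  assume "card D \<noteq> n"
  then have "bounded_program (n - 1) m D" "0 < n"
    using D by (auto simp: bounded_program_def)
  then have "card (answer_sets D) \<le> m ^ (n - 1)"
    using card_answer_sets_le[of m "n - 1" D] m2 by simp
  also have "\<dots> < m ^ n"
    using m2 \<open>0 < n\<close> by (intro power_strict_increasing) auto
  finally show False using ext by simp
qed

text \<open>Makes \<open>n - 1\<close> a genuine predecessor, so that
  \<open>m * m ^ (n - 1) = m ^ n\<close>.\<close>

lemma extremal_nonempty: "C \<in> D \<Longrightarrow> 0 < n"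
  using extremal_card D by (auto simp: bounded_program_def card_gt_0_iff)

lemma branch_le:
  assumes "C \<in> D" "(v, a) \<in> literals C"
  shows "card (branch D (v, a)) \<le> card (answer_sets (assign v a D))"
    "card (answer_sets (assign v a D)) \<le> m ^ (n - 1)"
  using card_answer_sets_le[OF _ bounded_program_assign[OF D assms]] card_branch_le[of v a D] m2
  by auto

text \<open>A shorter clause has fewer than \<open>m\<close> branches, each with at most
  \<open>m ^ (n - 1)\<close> answer sets.\<close>

lemma extremal_clause_length:
  assumes C: "C \<in> D"
  shows "clause_length C = m"
proof (rule ccontr)
  assume "clause_length C \<noteq> m"
  moreover have fC: "finite (clause_atoms C)" and "clause_length C \<le> m"
    using C D by (auto simp: bounded_program_def)
  ultimately have "card (literals C) < m"
    using card_literals_le[of C] by linarith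
  have "m ^ n \<le> card (literals C) * m ^ (n - 1)"
    unfolding ext[symmetric] answer_sets_eq_Union_branch[OF C]
    using branch_le[OF C] by (intro card_Union_branch_le finite_literals fC) (fastforce intro: le_trans)
  also have "\<dots> < m * m ^ (n - 1)"
    using \<open>card (literals C) < m\<close> m2 by simp
  also have "\<dots> = m ^ n"
    using extremal_nonempty[OF C] by (simp add: power_eq_if)
  finally show False by simp
qed

text \<open>At most \<open>m\<close> branches of size at most \<open>m ^ (n - 1)\<close> cover
  \<open>m ^ n\<close> sets, so no branch has any slack.\<close>

lemma extremal_branch:
  assumes C: "C \<in> D" and l: "l \<in> literals C"
  shows "card (branch D l) = m ^ (n - 1)"
proof (rule ccontr)
  assume ne: "card (branch D l) \<noteq> m ^ (n - 1)"
  have fC: "finite (clause_atoms C)"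
    using C D by (auto simp: bounded_program_def)
  note fL = finite_literals[OF fC]
  have le: "card (branch D k) \<le> m ^ (n - 1)" if "k \<in> literals C" for k
    using branch_le[OF C, of "fst k" "snd k"] that by simp
  have "m ^ n \<le> (\<Sum>k\<in>literals C. card (branch D k))"
    unfolding ext[symmetric] answer_sets_eq_Union_branch[OF C] by (rule card_UN_le[OF fL])
  also have "\<dots> < (\<Sum>k\<in>literals C. m ^ (n - 1))"
    using le order_le_imp_less_or_eq[OF le[OF l]] ne l
    by (intro sum_strict_mono_ex1[OF fL]) (auto intro!: bexI[of _ l] simp del: One_nat_def)
  also have "\<dots> \<le> m * m ^ (n - 1)"
    using card_literals_le[of C] extremal_clause_length[OF C] by simp
  also have "\<dots> = m ^ n"
    using extremal_nonempty[OF C] by (simp add: power_eq_if)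
  finally show False by simp
qed

end

lemma extremal_clauses_share_no_atom:
  assumes m2: "2 \<le> m" and D: "bounded_program n m D" and ext: "card (answer_sets D) = m ^ n"
    and C: "C \<in> D" "a \<in> clause_atoms C" and B: "B \<in> D" "a \<in> clause_atoms B"
  shows "B = C"
proof (rule ccontr)
  assume "B \<noteq> C"
  obtain v where va: "(v, a) \<in> literals C"
    using atom_in_literals[OF C(2)] by blast
  note bD' = bounded_program_assign[OF D C(1) va]
  \<comment> \<open>Extremality is inherited: the branch has \<open>m ^ (n - 1)\<close> elements and
    embeds into the answer sets of the simplified program, which has no more than that.\<close>
  have ext': "card (answer_sets (assign v a D)) = m ^ (n - 1)"
    using branch_le[OF m2 D ext C(1) va] extremal_branch[OF m2 D ext C(1) va] by simp
  have fin: "finite D" using D by (simp add: bounded_program_def)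
  \<comment> \<open>The simplified program has exactly \<open>n - 1\<close> clauses, and
    \<open>remove_atom\<close> can merge clauses but not create any. So every clause except
    \<open>C\<close> was kept.\<close>
  have "n - 1 \<le> card {C \<in> D. (v, a) \<notin> literals C}"
    using extremal_card[OF m2 bD' ext'] fin
      card_image_le[of "{C \<in> D. (v, a) \<notin> literals C}" "remove_atom a"]
    by (simp add: assign_def)
  moreover have "{C \<in> D. (v, a) \<notin> literals C} \<subseteq> D - {C}"
    using va by auto
  moreover have "card (D - {C}) = n - 1"
    using C(1) fin extremal_card[OF m2 D ext] by simp
  ultimately have "{C \<in> D. (v, a) \<notin> literals C} = D - {C}"
    using fin by (intro card_seteq) auto
  then have "remove_atom a B \<in> assign v a D"
    using B \<open>B \<noteq> C\<close> by (auto simp: assign_def)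
  \<comment> \<open>All clauses of the simplified program have full length, yet \<open>B\<close> has
    just lost the atom \<open>a\<close>.\<close>
  then have "clause_length (remove_atom a B) = m"
    by (rule extremal_clause_length[OF m2 bD' ext'])
  moreover have "clause_length B = m"
    by (rule extremal_clause_length[OF m2 D ext B(1)])
  moreover have "finite (clause_atoms B)"
    using B(1) D by (simp add: bounded_program_def)
  ultimately show False
    using clause_length_remove_atom_less[of B a] B(2) by simp
qed

lemma extremal_bodies_empty:
  assumes m2: "2 \<le> m" and D: "bounded_program n m D" and ext: "card (answer_sets D) = m ^ n"
    and C: "C \<in> D"
  shows "pos_body C = {} \<and> neg_body C = {}"
proof -
  \<comment> \<open>A clause supporting \<open>a\<close> shares it with \<open>C\<close>, hence is
    \<open>C\<close>; but a supporting clause does not have \<open>a\<close> in its body.\<close>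
  have no: "a \<notin> M" if "a \<in> pos_body C \<union> neg_body C" and M: "M \<in> answer_sets D" for a M
  proof
    assume "a \<in> M"
    then obtain B where B: "B \<in> D" "a \<in> heads B" "a \<notin> pos_body B" "a \<notin> neg_body B"
      using M answer_set_supported[of D M a] by (auto simp: answer_sets_def)
    then have "B = C"
      using that(1) by (intro extremal_clauses_share_no_atom[OF m2 D ext C, of a])
        (auto simp: clause_atoms_def)
    then show False using B that(1) by blast
  qed
  have False if a: "a \<in> pos_body C" for a
  proof -
    have "\<forall>M\<in>answer_sets D. a \<notin> M" using no a by blast
    \<comment> \<open>This branch is too large: it contains all \<open>m ^ n\<close> answer sets
      instead of \<open>m ^ (n - 1)\<close>.\<close>
    then have "branch D (False, a) = answer_sets D" by (auto simp: branch_def)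
    then have "m ^ n = m ^ (n - 1)"
      using extremal_branch[OF m2 D ext C, of "(False, a)"] a ext by (simp add: literals_iff)
    moreover have "m ^ (n - 1) < m ^ n"
      using m2 extremal_nonempty[OF m2 D ext C] by (intro power_strict_increasing) auto
    ultimately show False by simp
  qed
  moreover have False if a: "a \<in> neg_body C" for a
  proof -
    have "\<forall>M\<in>answer_sets D. a \<notin> M" using no a by blast
    then have "branch D (True, a) = {}" by (simp add: branch_def)
    then have "0 = m ^ (n - 1)"
      using extremal_branch[OF m2 D ext C, of "(True, a)"] a by (simp add: literals_iff)
    then show False using m2 by simp
  qed
  ultimately show ?thesis by blast
qed


section \<open>Disjunctive facts with disjoint heads\<close>

definition facts :: "'a set set \<Rightarrow> 'a program" where
  "facts A = (\<lambda>H. Clause H {} {}) ` A"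

text \<open>For \<open>1 \<le> m\<close>, the possible families of heads of a renamed
  \<open>D_prog n m\<close>, described without reference to a renaming.\<close>

definition block_family :: "nat \<Rightarrow> nat \<Rightarrow> 'a set set \<Rightarrow> bool" where
  "block_family n m A \<longleftrightarrow> finite A \<and> card A = n \<and> (\<forall>H\<in>A. finite H \<and> card H = m) \<and> pairwise disjnt A"

lemma facts_eqI:
  assumes "\<And>C. C \<in> D \<Longrightarrow> pos_body C = {} \<and> neg_body C = {}"
  shows "D = facts (heads ` D)"
proof -
  have "(\<lambda>C. Clause (heads C) {} {}) ` D = (\<lambda>C. C) ` D"
    using assms by (intro image_cong refl) (metis clause.collapse)
  then show ?thesis by (simp add: facts_def image_image)
qed

text \<open>The reduct of a set of facts does not depend on \<open>M\<close>, so the answer sets are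
  the minimal hitting sets of \<open>A\<close>.\<close>

lemma answer_set_facts_iff:
  "answer_set (facts A) M \<longleftrightarrow>
     (\<forall>H\<in>A. H \<inter> M \<noteq> {}) \<and> (\<forall>N. N \<subset> M \<longrightarrow> (\<exists>H\<in>A. H \<inter> N = {}))"
  by (simp add: answer_set_iff facts_def)

text \<open>Minimal hitting sets of disjoint blocks correspond to choice functions, one element per
  block.\<close>

lemma card_answer_sets_facts:
  assumes A: "block_family n m A"
  shows "card (answer_sets (facts A)) = m ^ n"
proof -
  have fin: "finite A" and cA: "card A = n" and cH: "\<And>H. H \<in> A \<Longrightarrow> card H = m"
    and dis: "\<And>H K x. H \<in> A \<Longrightarrow> K \<in> A \<Longrightarrow> x \<in> H \<Longrightarrow> x \<in> K \<Longrightarrow> H = K"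
    using A by (auto simp: block_family_def pairwise_def disjnt_iff)
  define F where "F = (\<Pi>\<^sub>E H\<in>A. H)"
  \<comment> \<open>Disjointness allows the choice function to be recovered from its set of
    values.\<close>
  have sel: "H \<inter> f ` A = {f H}" if "f \<in> F" "H \<in> A" for f H
    using that dis by (fastforce simp: F_def PiE_iff)
  have inj: "inj_on (\<lambda>f. f ` A) F"
  proof (rule inj_onI)
    fix f g assume fg: "f \<in> F" "g \<in> F" "f ` A = g ` A"
    then have "f H = g H" if "H \<in> A" for H
      using sel[OF fg(1) that] sel[OF fg(2) that] by simp
    then show "f = g"
      using fg by (auto simp: F_def intro: PiE_ext)
  qed
  have "(\<lambda>f. f ` A) ` F = answer_sets (facts A)"
  proof (intro set_eqI iffI)
    fix M assume "M \<in> (\<lambda>f. f ` A) ` F"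
    then obtain f where f: "f \<in> F" "M = f ` A" by blast
    have "\<exists>H\<in>A. H \<inter> N = {}" if N: "N \<subset> M" for N
    proof -
      obtain H where "H \<in> A" "f H \<notin> N" using N f by blast
      have "H \<inter> N \<subseteq> H \<inter> M" using N by auto
      also have "H \<inter> M = {f H}" using sel[OF f(1) \<open>H \<in> A\<close>] f(2) by simp
      finally have "H \<inter> N = {}" using \<open>f H \<notin> N\<close> by auto
      then show ?thesis using \<open>H \<in> A\<close> by blast
    qed
    then show "M \<in> answer_sets (facts A)"
      using sel[OF f(1)] f(2) by (auto simp: answer_sets_def answer_set_facts_iff)
  next
    fix M assume "M \<in> answer_sets (facts A)"
    then have hit: "\<And>H. H \<in> A \<Longrightarrow> H \<inter> M \<noteq> {}"
      and min: "\<And>N. N \<subset> M \<Longrightarrow> \<exists>H\<in>A. H \<inter> N = {}"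
      by (auto simp: answer_sets_def answer_set_facts_iff)
    \<comment> \<open>Any choice of elements of \<open>M\<close> from the blocks already hits every
      block, so minimality leaves nothing else in \<open>M\<close>. Restriction to \<open>A\<close>
      places \<open>f\<close> in the extensional function space.\<close>
    define f where "f = (\<lambda>H\<in>A. SOME x. x \<in> H \<inter> M)"
    have f: "f H \<in> H \<inter> M" if "H \<in> A" for H
      using hit[OF that] that some_in_eq[of "H \<inter> M"] by (simp add: f_def)
    then have "f \<in> F" by (auto simp: F_def f_def)
    have "\<not> f ` A \<subset> M"
      using min[of "f ` A"] f by blast
    then have "M = f ` A" using f by blast
    then show "M \<in> (\<lambda>f. f ` A) ` F" using \<open>f \<in> F\<close> by blast
  qed
  then have "card (answer_sets (facts A)) = card F"
    using card_image[OF inj] by simp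
  also have "\<dots> = m ^ n"
    using fin cH cA by (simp add: F_def card_PiE)
  finally show ?thesis .
qed

lemma facts_in_DP:
  assumes "1 \<le> m" "block_family n m A"
  shows "facts A \<in> DP n m"
proof -
  have "card (facts A) \<le> n"
    using assms by (auto simp: block_family_def facts_def intro: card_image_le)
  then show ?thesis
    using assms
    by (auto simp: block_family_def facts_def DP_def disjunctive_program_def wf_clause_def
        clause_length_def)
qed

section \<open>The program \<open>D_prog n m\<close> and its renamings\<close>

definition blocks :: "nat \<Rightarrow> nat \<Rightarrow> (nat \<times> nat) set set" where
  "blocks n m = (\<lambda>i. {i} \<times> {1..m}) ` {1..n}"

lemma D_prog_eq_facts: "D_prog n m = facts (blocks n m)"
proof -
  have "{(i, j) |j. j \<in> {1..m}} = {i} \<times> {1..m}" for i :: nat by auto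
  then show ?thesis by (simp only: D_prog_def facts_def blocks_def image_image)
qed

lemma atoms_D_prog: "atoms (D_prog n m) = {1..n} \<times> {1..m}"
  by (auto simp: D_prog_def atoms_def clause_atoms_def)

lemma block_family_image:
  assumes "1 \<le> m" "inj_on f ({1..n} \<times> {1..m})"
  shows "block_family n m ((`) f ` blocks n m)"
proof -
  have inj: "inj_on f ({i} \<times> {1..m})" if "i \<in> {1..n}" for i
    using assms(2) by (rule inj_on_subset) (use that in auto)
  have dis: "f ` ({i} \<times> {1..m}) \<inter> f ` ({j} \<times> {1..m}) = {}"
    if "i \<in> {1..n}" "j \<in> {1..n}" "i \<noteq> j" for i j
    using that assms(2) by (auto dest!: inj_onD)
  have "inj_on (\<lambda>i. f ` ({i} \<times> {1..m})) {1..n}"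
  proof (rule inj_onI, rule ccontr)
    fix i j assume ij: "i \<in> {1..n}" "j \<in> {1..n}" "f ` ({i} \<times> {1..m}) = f ` ({j} \<times> {1..m})" "i \<noteq> j"
    \<comment> \<open>Disjoint blocks can coincide only when empty, which \<open>1 \<le> m\<close>
      excludes; so there really are \<open>n\<close> of them.\<close>
    then have "f ` ({i} \<times> {1..m}) = {}" using dis[of i j] by simp
    then show False using assms(1) by simp
  qed
  then have "card ((`) f ` blocks n m) = n"
    by (simp add: blocks_def image_image card_image)
  moreover have "card (f ` ({i} \<times> {1..m})) = m" if "i \<in> {1..n}" for i
    using card_image[OF inj[OF that]] by (simp add: card_cartesian_product)
  moreover have "pairwise disjnt ((`) f ` blocks n m)"
    unfolding pairwise_def blocks_def disjnt_def using dis by blast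
  ultimately show ?thesis
    by (auto simp: block_family_def blocks_def)
qed

lemma rename_facts: "rename_clause f ` facts A = facts ((`) f ` A)"
  by (simp add: facts_def rename_clause_def image_image)

lemma equal_up_to_renaming_D_prog_iff:
  assumes "1 \<le> m"
  shows "equal_up_to_renaming (D_prog n m) D \<longleftrightarrow> (\<exists>A. block_family n m A \<and> D = facts A)"
proof
  assume "equal_up_to_renaming (D_prog n m) D"
  then obtain f where f: "inj_on f ({1..n} \<times> {1..m})" "D = rename_clause f ` D_prog n m"
    by (auto simp: equal_up_to_renaming_def atoms_D_prog)
  then show "\<exists>A. block_family n m A \<and> D = facts A"
    using block_family_image[OF assms f(1)] by (auto simp: D_prog_eq_facts rename_facts)
next
  assume "\<exists>A. block_family n m A \<and> D = facts A"
  then obtain A where A: "block_family n m A" and DA: "D = facts A" by blast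
  then have fin: "finite A" and cA: "card A = n" and dis: "pairwise disjnt A"
    and H: "\<And>H. H \<in> A \<Longrightarrow> finite H \<and> card H = m"
    by (auto simp: block_family_def)
  obtain g where g: "bij_betw g {1..n} A"
    using ex_bij_betw_nat_finite_1[OF fin] cA by auto
  have "\<exists>h. bij_betw h {1..m} H" if "H \<in> A" for H
    using ex_bij_betw_nat_finite_1[of H] H[OF that] by auto
  then obtain h where h: "\<And>H. H \<in> A \<Longrightarrow> bij_betw (h H) {1..m} H" by metis
  \<comment> \<open>The renaming combines a numbering \<open>g\<close> of the blocks with a
    numbering \<open>h H\<close> of the elements of each block \<open>H\<close>.\<close>
  define f where "f = (\<lambda>(i, j). h (g i) j)"
  have gA: "g i \<in> A" if "i \<in> {1..n}" for i
    using g that by (auto simp: bij_betw_def)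
  have img: "f ` ({i} \<times> {1..m}) = g i" if "i \<in> {1..n}" for i
  proof -
    have "f ` ({i} \<times> {1..m}) = h (g i) ` {1..m}" by (auto simp: f_def)
    then show ?thesis using h[OF gA[OF that]] by (simp add: bij_betw_def)
  qed
  have "inj_on f ({1..n} \<times> {1..m})"
  proof (rule inj_onI, clarify)
    fix i j i' j' assume a: "i \<in> {1..n}" "j \<in> {1..m}" "i' \<in> {1..n}" "j' \<in> {1..m}"
      and eq: "f (i, j) = f (i', j')"
    have "f (i, j) \<in> g i" "f (i', j') \<in> g i'"
      using img[OF a(1)] img[OF a(3)] a by blast+
    then have "g i = g i'"
      using dis gA a eq by (auto simp: pairwise_def disjnt_iff)
    then have "i = i'" using g a by (auto simp: bij_betw_def dest: inj_onD)
    moreover have "j = j'"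
      using eq a h[OF gA[OF a(1)]] \<open>i = i'\<close> by (auto simp: f_def bij_betw_def dest: inj_onD)
    ultimately show "i = i' \<and> j = j'" by simp
  qed
  moreover have "(`) f ` blocks n m = A"
  proof -
    have "(`) f ` blocks n m = g ` {1..n}"
      unfolding blocks_def image_image using img by (intro image_cong) auto
    then show ?thesis using g by (simp add: bij_betw_def)
  qed
  then have "D = rename_clause f ` D_prog n m"
    using DA by (simp add: D_prog_eq_facts rename_facts)
  ultimately show "equal_up_to_renaming (D_prog n m) D"
    by (auto simp: equal_up_to_renaming_def atoms_D_prog)
qed

section \<open>The shape of extremal programs\<close>

lemma facts_of_clauses:
  assumes D: "finite D" "card D = n" "1 \<le> m"
    and C: "\<And>C. C \<in> D \<Longrightarrow> pos_body C = {} \<and> neg_body C = {} \<and> clause_length C = m"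
    and dis: "\<And>B C a. B \<in> D \<Longrightarrow> C \<in> D \<Longrightarrow> a \<in> heads B \<Longrightarrow> a \<in> heads C \<Longrightarrow> B = C"
  shows "block_family n m (heads ` D) \<and> D = facts (heads ` D)"
proof
  show "D = facts (heads ` D)" using C by (intro facts_eqI) auto
  have "inj_on heads D"
    using C by (intro inj_onI clause.expand) auto
  moreover have card: "card (heads C) = m" if "C \<in> D" for C
    using C[OF that] by (auto simp: clause_length_def)
  \<comment> \<open>A nonzero \<open>card\<close> forces finiteness.\<close>
  moreover have "finite (heads C)" if "C \<in> D" for C
    using card[OF that] D(3) by (intro card_ge_0_finite) simp
  moreover have "pairwise disjnt (heads ` D)"
    using dis by (fastforce simp: pairwise_def disjnt_iff)
  ultimately show "block_family n m (heads ` D)"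
    using D by (auto simp: block_family_def card_image)
qed

lemma extremal_imp_facts:
  assumes m2: "2 \<le> m" and D: "bounded_program n m D" and ext: "card (answer_sets D) = m ^ n"
  shows "\<exists>A. block_family n m A \<and> D = facts A"
proof -
  have "finite D" using D by (simp add: bounded_program_def)
  then have "block_family n m (heads ` D) \<and> D = facts (heads ` D)"
    using extremal_card[OF m2 D ext] extremal_clause_length[OF m2 D ext]
      extremal_bodies_empty[OF m2 D ext] m2
    by (intro facts_of_clauses)
      (auto intro!: extremal_clauses_share_no_atom[OF m2 D ext] simp: clause_atoms_def)
  then show ?thesis by blast
qed

text \<open>For \<open>m = 1\<close> counting says nothing, as all powers of 1 agree. Instead, a
  nonempty head uses up the whole length, so each clause is a one-atom fact, and distinct such facts
  have distinct atoms.\<close>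

lemma DP_1_imp_facts:
  assumes D: "D \<in> DP n 1" and card: "card D = n"
  shows "\<exists>A. block_family n 1 A \<and> D = facts A"
proof -
  have C: "pos_body C = {} \<and> neg_body C = {} \<and> card (heads C) = 1" if "C \<in> D" for C
  proof -
    have wf: "wf_clause C" and len: "clause_length C \<le> 1"
      using D that by (auto simp: DP_def disjunctive_program_def)
    have "0 < card (heads C)"
      using wf by (simp add: wf_clause_def card_gt_0_iff)
    then have "card (heads C) = 1" "card (pos_body C) = 0" "card (neg_body C) = 0"
      using len unfolding clause_length_def by linarith+
    then show ?thesis using wf by (simp add: wf_clause_def)
  qed
  have "block_family n 1 (heads ` D) \<and> D = facts (heads ` D)"
  proof (rule facts_of_clauses)
    fix B C a assume "B \<in> D" "C \<in> D" "a \<in> heads B" "a \<in> heads C"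
    then have "heads B = heads C"
      using C by (metis card_1_singletonE singletonD)
    then show "B = C"
      using C[OF \<open>B \<in> D\<close>] C[OF \<open>C \<in> D\<close>] by (simp add: clause.expand)
  qed (use D card C in \<open>auto simp: DP_def disjunctive_program_def clause_length_def\<close>)
  then show ?thesis by blast
qed

text \<open>Infinitely many atoms leave room for a copy of the grid of pairs, so the bound is
  attained over \<open>'a\<close>.\<close>

lemma ex_block_family:
  assumes "1 \<le> m" "infinite (UNIV :: 'a set)"
  shows "\<exists>A :: 'a set set. block_family n m A"
proof -
  obtain g :: "nat \<Rightarrow> 'a" where "inj g"
    using infinite_countable_subset[OF assms(2)] by blast
  then have "inj_on (\<lambda>p. g (prod_encode p)) ({1..n} \<times> {1..m})"
    by (intro inj_onI) (simp add: inj_eq prod_encode_eq)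
  from block_family_image[OF assms(1) this] show ?thesis by blast
qed

theorem theorem9:
  fixes n m :: nat
  assumes "1 \<le> m" and "1 \<le> n"
  shows
    "(\<forall>D \<in> (DP n m :: 'a program set).
        finite (answer_sets D) \<and> card (answer_sets D) \<le> m ^ n) \<and>
     D_prog n m \<in> DP n m \<and> card (answer_sets (D_prog n m)) = m ^ n \<and>
     (\<forall>D \<in> (DP n m :: 'a program set). (m = 1 \<longrightarrow> card D = n) \<longrightarrow>
        (card (answer_sets D) = m ^ n \<longleftrightarrow> equal_up_to_renaming (D_prog n m) D)) \<and>
     (infinite (UNIV :: 'a set) \<longrightarrow> max_answer_sets TYPE('a) n m = m ^ n)"
proof (intro conjI ballI impI)
  fix D :: "'a program" assume D: "D \<in> DP n m"
  show "finite (answer_sets D)" "card (answer_sets D) \<le> m ^ n"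
    using card_answer_sets_le[OF assms(1) DP_bounded_program[OF D]] by auto
next
  have "block_family n m (blocks n m)"
    using block_family_image[OF assms(1), of id n] by simp
  then show "D_prog n m \<in> DP n m" "card (answer_sets (D_prog n m)) = m ^ n"
    unfolding D_prog_eq_facts using facts_in_DP assms(1) card_answer_sets_facts by blast+
next
  fix D :: "'a program" assume D: "D \<in> DP n m" and m1: "m = 1 \<longrightarrow> card D = n"
  show "card (answer_sets D) = m ^ n \<longleftrightarrow> equal_up_to_renaming (D_prog n m) D"
    unfolding equal_up_to_renaming_D_prog_iff[OF assms(1)]
  proof
    assume ext: "card (answer_sets D) = m ^ n"
    show "\<exists>A. block_family n m A \<and> D = facts A"
    proof (cases "m = 1")
      case True
      then show ?thesis using DP_1_imp_facts D m1 by blast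
    next
      case False
      then show ?thesis
        using extremal_imp_facts[OF _ DP_bounded_program[OF D] ext] assms(1) by simp
    qed
  qed (auto simp: card_answer_sets_facts)
next
  assume inf: "infinite (UNIV :: 'a set)"
  let ?S = "(\<lambda>D. card (answer_sets D)) ` (DP n m :: 'a program set)"
  have le: "k \<le> m ^ n" if "k \<in> ?S" for k
    using that card_answer_sets_le[OF assms(1) DP_bounded_program] by auto
  obtain A :: "'a set set" where A: "block_family n m A"
    using ex_block_family[OF assms(1) inf] by blast
  have "m ^ n \<in> ?S"
    using facts_in_DP[OF assms(1) A] card_answer_sets_facts[OF A] by (metis image_eqI)
  \<comment> \<open>\<open>Max\<close> needs a finite set: infinitely many programs give only
    finitely many counts, by the upper bound.\<close>
  moreover have "finite ?S"
    using le by (intro finite_subset[of ?S "{..m ^ n}"]) auto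
  ultimately show "max_answer_sets TYPE('a) n m = m ^ n"
    unfolding max_answer_sets_def using le by (intro Max_eqI) auto
qed

end
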